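(* Let $m\in\{0,\ldots,M-1\}$ and let $(\mathcal V^{m+1},\varkappa^{m+1},\kappa^{m+1},\vec X^{m+1})$ be a solution of the nonlinear scheme (N1)--(N4) given in the context. Then $$E_{\overline\varkappa}(\vec X^{m+1},\varkappa^{m+1})+2\pi\,\Delta t\,\bigl(\vec X^m\cdot\vec e_1\,(\mathcal V^{m+1})^2,\ |\vec X^m_\rho|\bigr)\ \le\ E_{\overline\varkappa}(\vec X^m,\varkappa^m),$$ for each $m=0,\ldots,M-1$.
   Context: Domain and spaces. Either $\mathbb I=\mathbb R/\mathbb Z$ (with $\partial\mathbb I=\emptyset$) or $\mathbb I=(0,1)$ (with $\partial\mathbb I=\{0,1\}$). $\vec e_1,\vec e_2$ is the standard basis of $\mathbb R^2$; $(\cdot)^\perp$ is clockwise rotation by $\pi/2$; $(\cdot,\cdot)$ is the $L^2$-inner product on $\mathbb I$; $\overline\varkappa\in\mathbb R$ is a given constant. Let $J\in\mathbb N$, $h=1/J$, $\rho_j=jh$, $\mathbb I_j=[\rho_{j-1},\rho_j]$, $j=1,\ldots,J$ (with $\rho_0=\rho_J$ identified if $\mathbb I=\mathbb R/\mathbb Z$). $V^h$ is the space of continuous functions on $\overline{\mathbb I}$ that are affine on each $\mathbb I_j$, and $\underline V_\partial^h=\{\vec\eta\in[V^h]^2:\ \vec\eta(\rho)\cdot\vec e_1=0\ \forall\rho\in\partial\mathbb I\}$. The mass-lumped product is $(u,v)^h=\frac h2\sum_{j=1}^J[(u\cdot v)(\rho_j^-)+(u\cdot v)(\rho_{j-1}^+)]$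 for piecewise continuous $u,v$ with possible jumps at nodes. Energy: $E_{\overline\varkappa}(\vec X,\varkappa)=\pi\int_{\mathbb I}\vec X\cdot\vec e_1\,(\varkappa-\overline\varkappa)^2\,|\vec X_\rho|\,d\rho$. Time discretization: $\Delta t=T/M$, $t_m=m\Delta t$. Standing assumption: for $m=0,1,\ldots,M$, $\vec X^m\in\underline V_\partial^h$ satisfies $\vec X^m\cdot\vec e_1>0$ in $\overline{\mathbb I}\setminus\partial\mathbb I$ and $|\vec X^m_\rho|>0$ in $\overline{\mathbb I}$. Set $\vec\tau^m=\vec X^m_\rho/|\vec X^m_\rho|$ and $\vec\nu^m=-(\vec\tau^m)^\perp$. Nonlinear scheme. Given $\vec X^0\in\underline V_\partial^h$ and $\varkappa^0,\kappa^0\in V^h$, for $m=0,\ldots,M-1$ find $\mathcal V^{m+1},\varkappa^{m+1},\kappa^{m+1}\in V^h$ and $\vec X^{m+1}\in\underline V_\partial^h$ such that (N1) for all $\varphi^h\in V^h$: $(\vec X^m\cdot\vec e_1\,\mathcal V^{m+1},\varphi^h|\vec X^m_\rho|)-(\vec X^m\cdot\vec e_1\,\varkappa^{m+1}_\rho,\varphi^h_\rho|\vec X^m_\rho|^{-1})+2(\vec\nu^m\cdot\vec e_1\,\kappa^m(\varkappa^{m+1}-\overline\varkappa),\varphi^h|\vec X^m_\rho|)+\frac12(\vec X^m\cdot\vec e_1\,(\varkappa^m+\overline\varkappa)\varkappa^m(\varkappa^{m+1}-\overline\varkappa),\varphi^h|\vec X^m_\rho|)=0$; (N2) for all $\chi^h\in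 V^h$: $\bigl(\vec X^m\cdot\vec e_1\,\frac{\varkappa^{m+1}-\varkappa^m}{\Delta t},\chi^h|\vec X^m_\rho|\bigr)+\frac12\bigl(\frac{\vec X^{m+1}-\vec X^m}{\Delta t}\cdot\vec e_1\,|\vec X^{m+1}_\rho|,(\varkappa^{m+1}-\overline\varkappa)\chi^h\bigr)+\frac12\bigl(\vec X^m\cdot\vec e_1\,\frac{(\vec X^{m+1}-\vec X^m)_\rho\cdot\vec X^{m+1}_\rho}{\Delta t\,|\vec X^m_\rho|},(\varkappa^{m+1}-\overline\varkappa)\chi^h\bigr)+(\vec X^m\cdot\vec e_1\,\mathcal V^{m+1}_\rho,\chi^h_\rho|\vec X^m_\rho|^{-1})-2(\vec\nu^m\cdot\vec e_1\,\kappa^m\mathcal V^{m+1},\chi^h|\vec X^m_\rho|)-\frac12(\vec X^m\cdot\vec e_1\,(\varkappa^m+\overline\varkappa)\varkappa^m\mathcal V^{m+1},\chi^h|\vec X^m_\rho|)-\frac12\bigl(\vec X^m\cdot\vec e_1\,\frac{(\vec X^{m+1}-\vec X^m)\cdot\vec\tau^m}{\Delta t},\varkappa^{m+1}_\rho\chi^h-(\varkappa^{m+1}-\overline\varkappa)\chi^h_\rho\bigr)=0$; (N3) for all $\xi^h\in V^h$: $\bigl(\frac{\vec X^{m+1}-\vec X^m}{\Delta t}\cdot\vec\nu^m,\xi^h|\vec X^m_\rho|\bigr)^h-(\mathcal V^{m+1},\xi^h|\vec X^m_\rho|)=0$; (N4) for all $\vec\eta^h\in\underline V_\partial^h$: $(\kappa^{m+1}\vec\nu^m,\vec\eta^h|\vec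 X^m_\rho|)^h+(\vec X^{m+1}_\rho,\vec\eta^h_\rho|\vec X^m_\rho|^{-1})=0$. *)

theory Defs
  imports "HOL-Analysis.Analysis"
begin

text \<open>
  Functions on the closure of the parameter domain are represented by functions on the reals of
  which only the values on \<open>[0,1]\<close> matter; for \<open>\<real>/\<int>\<close> the points 0 and 1 are identified, so the
  values there have to agree (see \<open>Vh\<close>).
\<close>

datatype domain = Circle | Unit_Interval

fun bdry :: "domain \<Rightarrow> real set" where
  "bdry Circle = {}"
| "bdry Unit_Interval = {0, 1}"

abbreviation e1 :: "real^2" where
  "e1 \<equiv> axis 1 1"

text \<open>Clockwise rotation by \<open>\<pi>/2\<close>.\<close>

definition perp :: "real^2 \<Rightarrow> real^2" where
  "perp v = vector [v $ 2, - v $ 1]"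

definition mesh_size :: "nat \<Rightarrow> real" where
  "mesh_size J = 1 / real J"

definition node :: "nat \<Rightarrow> nat \<Rightarrow> real" where
  "node J j = real j * mesh_size J"

definition elem :: "nat \<Rightarrow> nat \<Rightarrow> real set" where
  "elem J j = {node J (j - 1)..node J j}"

definition Vh :: "domain \<Rightarrow> nat \<Rightarrow> (real \<Rightarrow> real) set" where
  "Vh \<I> J = {f. continuous_on {0..1} f \<and> (\<I> = Circle \<longrightarrow> f 0 = f 1) \<and>
     (\<forall>j\<in>{1..J}. \<exists>a b. \<forall>\<rho>\<in>elem J j. f \<rho> = a + b * \<rho>)}"

definition Vh_bdry :: "domain \<Rightarrow> nat \<Rightarrow> (real \<Rightarrow> real^2) set" where
  "Vh_bdry \<I> J = {\<eta>. (\<forall>i. (\<lambda>\<rho>. \<eta> \<rho> $ i) \<in> Vh \<I> J) \<and> (\<forall>\<rho>\<in>bdry \<I>. \<eta> \<rho> \<bullet> e1 = 0)}"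

text \<open>
  The derivative with respect to \<open>\<rho>\<close>. For finite element functions it exists except possibly at the
  nodes, where the value is irrelevant: it is only used under integrals and one-sided limits.
\<close>

abbreviation D :: "(real \<Rightarrow> 'a::real_normed_vector) \<Rightarrow> real \<Rightarrow> 'a" where
  "D f \<rho> \<equiv> vector_derivative f (at \<rho>)"

definition L2 :: "(real \<Rightarrow> 'a::real_inner) \<Rightarrow> (real \<Rightarrow> 'a) \<Rightarrow> real" where
  "L2 u v = integral {0..1} (\<lambda>\<rho>. u \<rho> \<bullet> v \<rho>)"

definition lumped :: "nat \<Rightarrow> (real \<Rightarrow> 'a::real_inner) \<Rightarrow> (real \<Rightarrow> 'a) \<Rightarrow> real" where
  "lumped J u v = mesh_size J / 2 *
     (\<Sum>j=1..J. Lim (at_left (node J j)) (\<lambda>\<rho>. u \<rho> \<bullet> v \<rho>)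
              + Lim (at_right (node J (j - 1))) (\<lambda>\<rho>. u \<rho> \<bullet> v \<rho>))"

definition energy :: "real \<Rightarrow> (real \<Rightarrow> real^2) \<Rightarrow> (real \<Rightarrow> real) \<Rightarrow> real" where
  "energy kbar X vk = pi * integral {0..1} (\<lambda>\<rho>. (X \<rho> \<bullet> e1) * (vk \<rho> - kbar)\<^sup>2 * norm (D X \<rho>))"

definition tangent :: "(real \<Rightarrow> real^2) \<Rightarrow> real \<Rightarrow> real^2" where
  "tangent X \<rho> = D X \<rho> /\<^sub>R norm (D X \<rho>)"

definition normal :: "(real \<Rightarrow> real^2) \<Rightarrow> real \<Rightarrow> real^2" where
  "normal X \<rho> = - perp (tangent X \<rho>)"

text \<open>
  The nondegeneracy condition \<open>|X\<^sub>\<rho>| > 0\<close> on the closure of the domain is read elementwise, so at a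
  node it concerns both one-sided derivatives.
\<close>

definition admissible :: "domain \<Rightarrow> nat \<Rightarrow> (real \<Rightarrow> real^2) \<Rightarrow> bool" where
  "admissible \<I> J X \<longleftrightarrow> X \<in> Vh_bdry \<I> J \<and>
     (\<forall>\<rho>\<in>{0..1} - bdry \<I>. X \<rho> \<bullet> e1 > 0) \<and>
     (\<forall>j\<in>{1..J}. \<forall>\<rho>\<in>elem J j. norm (vector_derivative X (at \<rho> within elem J j)) > 0)"

text \<open>
  One time step: \<open>X\<close>, \<open>vk\<close>, \<open>\<kappa>\<close> are the given data, primed quantities are the unknowns. Here \<open>vk\<close> and
  \<open>kbar\<close> stand for the two curvatures written with a varkappa, \<open>\<kappa>\<close> for the curvature of the curve.
\<close>

definition scheme_step ::
  "domain \<Rightarrow> nat \<Rightarrow> real \<Rightarrow> real \<Rightarrow>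
   (real \<Rightarrow> real^2) \<Rightarrow> (real \<Rightarrow> real) \<Rightarrow> (real \<Rightarrow> real) \<Rightarrow>
   (real \<Rightarrow> real) \<Rightarrow> (real \<Rightarrow> real) \<Rightarrow> (real \<Rightarrow> real) \<Rightarrow> (real \<Rightarrow> real^2) \<Rightarrow> bool" where
  "scheme_step \<I> J kbar \<Delta>t X vk \<kappa> V' vk' \<kappa>' X' \<longleftrightarrow>
     V' \<in> Vh \<I> J \<and> vk' \<in> Vh \<I> J \<and> \<kappa>' \<in> Vh \<I> J \<and> X' \<in> Vh_bdry \<I> J \<and>
     (\<forall>\<phi>\<in>Vh \<I> J.
        L2 (\<lambda>\<rho>. (X \<rho> \<bullet> e1) * V' \<rho>) (\<lambda>\<rho>. \<phi> \<rho> * norm (D X \<rho>))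
      - L2 (\<lambda>\<rho>. (X \<rho> \<bullet> e1) * D vk' \<rho>) (\<lambda>\<rho>. D \<phi> \<rho> * inverse (norm (D X \<rho>)))
      + 2 * L2 (\<lambda>\<rho>. (normal X \<rho> \<bullet> e1) * \<kappa> \<rho> * (vk' \<rho> - kbar)) (\<lambda>\<rho>. \<phi> \<rho> * norm (D X \<rho>))
      + 1/2 * L2 (\<lambda>\<rho>. (X \<rho> \<bullet> e1) * (vk \<rho> + kbar) * vk \<rho> * (vk' \<rho> - kbar))
                 (\<lambda>\<rho>. \<phi> \<rho> * norm (D X \<rho>))
      = 0) \<and>
     (\<forall>\<zeta>\<in>Vh \<I> J.
        L2 (\<lambda>\<rho>. (X \<rho> \<bullet> e1) * ((vk' \<rho> - vk \<rho>) / \<Delta>t)) (\<lambda>\<rho>. \<zeta> \<rho> * norm (D X \<rho>))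
      + 1/2 * L2 (\<lambda>\<rho>. (((X' \<rho> - X \<rho>) /\<^sub>R \<Delta>t) \<bullet> e1) * norm (D X' \<rho>))
                 (\<lambda>\<rho>. (vk' \<rho> - kbar) * \<zeta> \<rho>)
      + 1/2 * L2 (\<lambda>\<rho>. (X \<rho> \<bullet> e1) *
                      ((D (\<lambda>\<rho>. X' \<rho> - X \<rho>) \<rho> \<bullet> D X' \<rho>) / (\<Delta>t * norm (D X \<rho>))))
                 (\<lambda>\<rho>. (vk' \<rho> - kbar) * \<zeta> \<rho>)
      + L2 (\<lambda>\<rho>. (X \<rho> \<bullet> e1) * D V' \<rho>) (\<lambda>\<rho>. D \<zeta> \<rho> * inverse (norm (D X \<rho>)))
      - 2 * L2 (\<lambda>\<rho>. (normal X \<rho> \<bullet> e1) * \<kappa> \<rho> * V' \<rho>) (\<lambda>\<rho>. \<zeta> \<rho> * norm (D X \<rho>))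
      - 1/2 * L2 (\<lambda>\<rho>. (X \<rho> \<bullet> e1) * (vk \<rho> + kbar) * vk \<rho> * V' \<rho>) (\<lambda>\<rho>. \<zeta> \<rho> * norm (D X \<rho>))
      - 1/2 * L2 (\<lambda>\<rho>. (X \<rho> \<bullet> e1) * (((X' \<rho> - X \<rho>) \<bullet> tangent X \<rho>) / \<Delta>t))
                 (\<lambda>\<rho>. D vk' \<rho> * \<zeta> \<rho> - (vk' \<rho> - kbar) * D \<zeta> \<rho>)
      = 0) \<and>
     (\<forall>\<xi>\<in>Vh \<I> J.
        lumped J (\<lambda>\<rho>. ((X' \<rho> - X \<rho>) /\<^sub>R \<Delta>t) \<bullet> normal X \<rho>) (\<lambda>\<rho>. \<xi> \<rho> * norm (D X \<rho>))
      - L2 V' (\<lambda>\<rho>. \<xi> \<rho> * norm (D X \<rho>))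
      = 0) \<and>
     (\<forall>\<eta>\<in>Vh_bdry \<I> J.
        lumped J (\<lambda>\<rho>. \<kappa>' \<rho> *\<^sub>R normal X \<rho>) (\<lambda>\<rho>. norm (D X \<rho>) *\<^sub>R \<eta> \<rho>)
      + L2 (D X') (\<lambda>\<rho>. inverse (norm (D X \<rho>)) *\<^sub>R D \<eta> \<rho>)
      = 0)"

end

theory Submission
  imports Defs
begin

text \<open>
  Write \<open>a = vk - kbar\<close> for the deviation of the mean curvature from its spontaneous value. The
  scheme is arranged so that testing the velocity equation with the new velocity and the curvature
  equation with the new deviation makes every coupling term appear twice with opposite signs,
  while the tangential convection term vanishes by antisymmetry. What is left
  (\<open>scheme_step_energy_identity\<close>) balances the dissipation against three discrete time
  differences: of the deviation, of the radial coordinate and of the length element.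

  These three differences together dominate the increment of the energy density, pointwise
  (\<open>energy_density_increment_le\<close>). By the discrete product rule
  \<open>s' p a'\<^sup>2 - s q a\<^sup>2 = s q (a'\<^sup>2 - a\<^sup>2) + s (p - q) a'\<^sup>2 + (s' - s) p a'\<^sup>2\<close>, where \<open>s\<close> is the radial
  coordinate, \<open>q\<close> and \<open>p\<close> are the old and the new length element, and primes mark the new time
  level. The last summand occurs in the scheme as it stands; the first is bounded by convexity of
  the square, the second by the Cauchy--Schwarz inequality and \<open>p - q \<le> p (p - q) / q\<close>.

  The pointwise estimate holds off the nodes, hence almost everywhere. To integrate it
  (\<open>energy_increment_le\<close>) one needs integrability: all integrands are products of a continuous
  function and a function of derivatives of finite element functions, which are constant inside
  each element (\<open>integrable_continuous_times_pw_const\<close>).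
\<close>

section \<open>The mesh\<close>

lemma node_0 [simp]: "node J 0 = 0"
  by (simp add: node_def)

lemma node_last: "J \<ge> 1 \<Longrightarrow> node J J = 1"
  by (simp add: node_def mesh_size_def)

lemma node_mono: "i \<le> j \<Longrightarrow> node J i \<le> node J j"
  by (simp add: node_def mesh_size_def divide_right_mono)

lemma node_in_unit: "j \<le> J \<Longrightarrow> J \<ge> 1 \<Longrightarrow> node J j \<in> {0..1}"
  using node_mono[of 0 j J] node_mono[of j J J] node_last[of J] by simp

lemma in_open_element:
  assumes "J \<ge> 1" and "\<rho> \<in> {0..1}" and "\<rho> \<notin> node J ` {0..J}"
  obtains j where "j \<in> {1..J}" and "node J (j - 1) < \<rho>" and "\<rho> < node J j"
proof -
  define j where "j = (LEAST j. \<rho> \<le> node J j)"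
  have ex: "\<rho> \<le> node J J"
    using assms node_last by simp
  have le: "\<rho> \<le> node J j"
    unfolding j_def using ex by (rule LeastI)
  have jJ: "j \<le> J"
    unfolding j_def using ex by (rule Least_le)
  have ne: "\<rho> \<noteq> node J i" if "i \<le> J" for i
    using assms(3) that by auto
  have "j \<noteq> 0"
    using le ne[of 0] assms(2) by (intro notI) simp
  then have "\<not> \<rho> \<le> node J (j - 1)"
    unfolding j_def by (intro not_less_Least) simp
  with le jJ ne[of j] \<open>j \<noteq> 0\<close> show thesis
    by (intro that[of j]) auto
qed

section \<open>Piecewise affine and piecewise constant functions\<close>

definition pw_affine :: "nat \<Rightarrow> (real \<Rightarrow> 'a::real_vector) \<Rightarrow> bool" where
  "pw_affine J f \<longleftrightarrow> (\<forall>j\<in>{1..J}. \<exists>a b. \<forall>\<rho>\<in>elem J j. f \<rho> = a + \<rho> *\<^sub>R b)"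

text \<open>
  Values at the nodes are unconstrained, since derivatives of finite element functions have no
  meaningful value there.
\<close>

definition pw_const :: "nat \<Rightarrow> (real \<Rightarrow> 'a) \<Rightarrow> bool" where
  "pw_const J c \<longleftrightarrow> (\<forall>j\<in>{1..J}. \<exists>b. \<forall>\<rho>\<in>{node J (j - 1)<..<node J j}. c \<rho> = b)"

lemma pw_const_compose2:
  assumes "pw_const J c" and "pw_const J d"
  shows "pw_const J (\<lambda>\<rho>. F (c \<rho>) (d \<rho>))"
  using assms unfolding pw_const_def by fastforce

lemma pw_const_compose:
  assumes "pw_const J c"
  shows "pw_const J (\<lambda>\<rho>. F (c \<rho>))"
  using assms unfolding pw_const_def by fastforce

lemma pw_affine_diff:
  assumes "pw_affine J f" and "pw_affine J g"
  shows "pw_affine J (\<lambda>\<rho>. f \<rho> - g \<rho>)"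
  unfolding pw_affine_def
proof
  fix j assume j: "j \<in> {1..J}"
  obtain a b where f: "\<forall>\<rho>\<in>elem J j. f \<rho> = a + \<rho> *\<^sub>R b"
    using assms(1) j unfolding pw_affine_def by blast
  obtain c d where g: "\<forall>\<rho>\<in>elem J j. g \<rho> = c + \<rho> *\<^sub>R d"
    using assms(2) j unfolding pw_affine_def by blast
  have "\<forall>\<rho>\<in>elem J j. f \<rho> - g \<rho> = (a - c) + \<rho> *\<^sub>R (b - d)"
    using f g by (simp add: algebra_simps)
  then show "\<exists>a b. \<forall>\<rho>\<in>elem J j. f \<rho> - g \<rho> = a + \<rho> *\<^sub>R b"
    by blast
qed

lemma pw_affine_has_vector_derivative:
  fixes f :: "real \<Rightarrow> 'a::real_normed_vector"
  assumes "pw_affine J f" and "j \<in> {1..J}"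
  obtains b where "\<And>\<rho>. \<rho> \<in> {node J (j - 1)<..<node J j} \<Longrightarrow> (f has_vector_derivative b) (at \<rho>)"
proof -
  obtain a b where f: "\<forall>\<rho>\<in>elem J j. f \<rho> = a + \<rho> *\<^sub>R b"
    using assms unfolding pw_affine_def by blast
  have "(f has_vector_derivative b) (at \<rho>)" if "\<rho> \<in> {node J (j - 1)<..<node J j}" for \<rho>
  proof (rule has_vector_derivative_transform_within_open)
    show "((\<lambda>\<rho>. a + \<rho> *\<^sub>R b) has_vector_derivative b) (at \<rho>)"
      by (auto intro!: derivative_eq_intros)
    show "a + x *\<^sub>R b = f x" if "x \<in> {node J (j - 1)<..<node J j}" for x
      using f that by (simp add: elem_def)
  qed (use that in auto)
  then show thesis
    by (rule that)
qed

lemma pw_const_D: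
  assumes "pw_affine J f"
  shows "pw_const J (D f)"
  unfolding pw_const_def
proof
  fix j assume "j \<in> {1..J}"
  then obtain b where "\<And>\<rho>. \<rho> \<in> {node J (j - 1)<..<node J j} \<Longrightarrow> (f has_vector_derivative b) (at \<rho>)"
    using pw_affine_has_vector_derivative[OF assms] by blast
  then have "\<forall>\<rho>\<in>{node J (j - 1)<..<node J j}. D f \<rho> = b"
    by (simp add: vector_derivative_at)
  then show "\<exists>b. \<forall>\<rho>\<in>{node J (j - 1)<..<node J j}. D f \<rho> = b" ..
qed

lemma pw_affine_differentiable:
  fixes f :: "real \<Rightarrow> 'a::real_normed_vector"
  assumes "pw_affine J f" and "J \<ge> 1" and "\<rho> \<in> {0..1}" and "\<rho> \<notin> node J ` {0..J}"
  shows "f differentiable at \<rho>"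
proof -
  obtain j where j: "j \<in> {1..J}" and \<rho>: "node J (j - 1) < \<rho>" "\<rho> < node J j"
    using in_open_element[OF assms(2-4)] .
  obtain b where "\<And>\<rho>. \<rho> \<in> {node J (j - 1)<..<node J j} \<Longrightarrow> (f has_vector_derivative b) (at \<rho>)"
    using pw_affine_has_vector_derivative[OF assms(1) j] by blast
  then have "(f has_vector_derivative b) (at \<rho>)"
    using \<rho> by simp
  then show ?thesis
    by (rule differentiableI_vector)
qed

text \<open>
  Inside an element the product is a continuous function up to a constant factor, so it is
  integrable there; the elements are then joined one after the other.
\<close>

lemma integrable_continuous_times_pw_const:
  fixes f c :: "real \<Rightarrow> real"
  assumes f: "continuous_on {0..1} f" and c: "pw_const J c" and J: "J \<ge> 1"
  shows "(\<lambda>\<rho>. f \<rho> * c \<rho>) integrable_on {0..1}"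
proof -
  have "(\<lambda>\<rho>. f \<rho> * c \<rho>) integrable_on {0..node J k}" if "k \<le> J" for k
    using that
  proof (induction k)
    case 0
    show ?case
      using integrable_on_refl[of _ "0::real"] by simp
  next
    case (Suc k)
    obtain b where b: "\<forall>\<rho>\<in>{node J k<..<node J (Suc k)}. c \<rho> = b"
      using c Suc.prems unfolding pw_const_def by force
    have sub: "{node J k..node J (Suc k)} \<subseteq> {0..1}"
      using node_in_unit[of k J] node_in_unit[of "Suc k" J] Suc.prems J by auto
    have "(\<lambda>\<rho>. f \<rho> * b) integrable_on {node J k..node J (Suc k)}"
      by (intro integrable_continuous_interval continuous_intros continuous_on_subset[OF f sub])
    then have "(\<lambda>\<rho>. f \<rho> * c \<rho>) integrable_on {node J k..node J (Suc k)}"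
      by (rule integrable_spike_finite[rotated 2, of _ _ "{node J k, node J (Suc k)}"])
         (use b in auto)
    moreover have "(\<lambda>\<rho>. f \<rho> * c \<rho>) integrable_on {0..node J k}"
      using Suc by simp
    moreover have "0 \<le> node J k" and "node J k \<le> node J (Suc k)"
      using node_mono[of 0 k J] node_mono[of k "Suc k" J] by simp_all
    ultimately show ?case
      using Henstock_Kurzweil_Integration.integrable_combine by blast
  qed
  from this[of J] show ?thesis
    using J by (simp add: node_last)
qed

lemma integral_le_off_finite:
  fixes f g :: "real \<Rightarrow> real"
  assumes "finite N" and "f integrable_on S" and "g integrable_on S"
    and le: "\<And>x. x \<in> S - N \<Longrightarrow> f x \<le> g x"
  shows "integral S f \<le> integral S g"
proof -
  define h where "h x = (if x \<in> N then g x else f x)" for x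
  have "h integrable_on S"
    by (rule integrable_spike_finite[OF assms(1) _ assms(2)]) (simp add: h_def)
  moreover have "integral S f = integral S h"
    using assms(1) by (intro integral_spike[of N] negligible_finite) (auto simp: h_def)
  moreover have "h x \<le> g x" if "x \<in> S" for x
    using le that by (simp add: h_def)
  ultimately show ?thesis
    using assms(3) by (simp add: integral_le)
qed

section \<open>Finite element functions\<close>

lemma Vh_continuous: "f \<in> Vh \<I> J \<Longrightarrow> continuous_on {0..1} f"
  by (simp add: Vh_def)

lemma Vh_diff_const:
  assumes "f \<in> Vh \<I> J"
  shows "(\<lambda>\<rho>. f \<rho> - c) \<in> Vh \<I> J"
proof -
  have "\<exists>a b. \<forall>\<rho>\<in>elem J j. f \<rho> - c = a + b * \<rho>" if j: "j \<in> {1..J}" for j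
  proof -
    obtain a b where "\<forall>\<rho>\<in>elem J j. f \<rho> = a + b * \<rho>"
      using assms j unfolding Vh_def by blast
    then have "\<forall>\<rho>\<in>elem J j. f \<rho> - c = (a - c) + b * \<rho>"
      by simp
    then show ?thesis
      by blast
  qed
  then show ?thesis
    using assms unfolding Vh_def by (simp add: continuous_on_diff)
qed

lemma Vh_bdry_continuous:
  assumes "X \<in> Vh_bdry \<I> J"
  shows "continuous_on {0..1} X"
proof -
  have "continuous_on {0..1} (\<lambda>\<rho>. \<chi> i. X \<rho> $ i)"
    using assms by (intro continuous_on_vec_lambda Vh_continuous[of _ \<I> J]) (simp add: Vh_bdry_def)
  then show ?thesis
    by simp
qed

lemma Vh_bdry_pw_affine:
  assumes "X \<in> Vh_bdry \<I> J"
  shows "pw_affine J X"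
  unfolding pw_affine_def
proof
  fix j assume j: "j \<in> {1..J}"
  have "\<exists>a b. \<forall>\<rho>\<in>elem J j. X \<rho> $ i = a + b * \<rho>" for i
    using assms j by (simp add: Vh_bdry_def Vh_def)
  then obtain a b where "\<And>i. \<forall>\<rho>\<in>elem J j. X \<rho> $ i = a i + b i * \<rho>"
    by metis
  then have "\<forall>\<rho>\<in>elem J j. X \<rho> = (\<chi> i. a i) + \<rho> *\<^sub>R (\<chi> i. b i)"
    by (simp add: vec_eq_iff mult.commute)
  then show "\<exists>a b. \<forall>\<rho>\<in>elem J j. X \<rho> = a + \<rho> *\<^sub>R b"
    by blast
qed

lemma admissible_radius_nonneg:
  assumes "admissible \<I> J X" and "\<rho> \<in> {0..1}"
  shows "X \<rho> \<bullet> e1 \<ge> 0"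
  using assms by (cases "\<rho> \<in> bdry \<I>") (auto simp: admissible_def Vh_bdry_def less_imp_le)

lemma admissible_speed_pos:
  assumes "admissible \<I> J X" and "J \<ge> 1" and "\<rho> \<in> {0..1}" and "\<rho> \<notin> node J ` {0..J}"
  shows "norm (D X \<rho>) > 0"
proof -
  obtain j where j: "j \<in> {1..J}" "node J (j - 1) < \<rho>" "\<rho> < node J j"
    using in_open_element[OF assms(2-4)] by blast
  then have "norm (vector_derivative X (at \<rho> within elem J j)) > 0"
    using assms(1) by (simp add: admissible_def elem_def)
  moreover have "at \<rho> within elem J j = at \<rho>"
    unfolding elem_def by (rule at_within_Icc_at) (use j in auto)
  ultimately show ?thesis
    by simp
qed

text \<open>The identity holds without differentiability, because both sides then denote the same choice.\<close>

lemma D_diff_const: "D (\<lambda>\<rho>. f \<rho> - c) \<rho> = D f \<rho>"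
  by (simp add: vector_derivative_def has_vector_derivative_diff_const)

section \<open>Energy stability\<close>

text \<open>
  Here \<open>s\<close>, \<open>a\<close>, \<open>w\<close> stand for the radial coordinate, the curvature deviation and the derivative of
  the curve at one parameter value; primes mark the new time level.
\<close>

lemma energy_density_increment_le:
  fixes w w' :: "'a::real_inner" and s s' a a' :: real
  assumes s: "s \<ge> 0" and w: "norm w > 0"
  shows "s' * a'\<^sup>2 * norm w' - s * a\<^sup>2 * norm w
    \<le> 2 * (s * (a' - a) * a' * norm w) + (s' - s) * norm w' * a'\<^sup>2
      + s * (((w' - w) \<bullet> w') / norm w) * a'\<^sup>2"
proof -
  define p q where "p = norm w'" and "q = norm w"
  have q: "q > 0"
    using w by (simp add: q_def)
  have "p * (p - q) \<le> (w' - w) \<bullet> w'"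
    using norm_cauchy_schwarz[of w w']
    by (simp add: p_def q_def inner_diff_left power2_norm_eq_inner[symmetric] power2_eq_square
        algebra_simps)
  moreover have "(p - q) * q \<le> p * (p - q)"
    using zero_le_square[of "p - q"] by (simp add: algebra_simps)
  ultimately have "p - q \<le> ((w' - w) \<bullet> w') / q"
    using q by (simp add: pos_le_divide_eq)
  then have length: "s * (p - q) * a'\<^sup>2 \<le> s * (((w' - w) \<bullet> w') / q) * a'\<^sup>2"
    using s by (intro mult_right_mono mult_left_mono) auto
  have "a'\<^sup>2 - a\<^sup>2 \<le> 2 * ((a' - a) * a')"
    using zero_le_power2[of "a' - a"] by (simp add: power2_eq_square algebra_simps)
  then have "(s * q) * (a'\<^sup>2 - a\<^sup>2) \<le> (s * q) * (2 * ((a' - a) * a'))"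
    using s q by (intro mult_left_mono) auto
  then show ?thesis
    unfolding p_def[symmetric] q_def[symmetric] using length by (simp add: algebra_simps)
qed

text \<open>
  The deviation and the new velocity are themselves finite element functions, so they are
  admissible tests. The scheme convects tangentially through the antisymmetric form
  \<open>D vk' * \<zeta> - a' * D \<zeta>\<close>, which is zero for \<open>\<zeta> = a'\<close>.
\<close>

lemma scheme_step_energy_identity:
  assumes "scheme_step \<I> J kbar \<Delta>t X vk \<kappa> V' vk' \<kappa>' X'"
  defines "a' \<equiv> \<lambda>\<rho>. vk' \<rho> - kbar"
  shows "L2 (\<lambda>\<rho>. (X \<rho> \<bullet> e1) * ((vk' \<rho> - vk \<rho>) / \<Delta>t)) (\<lambda>\<rho>. a' \<rho> * norm (D X \<rho>))
    + 1/2 * L2 (\<lambda>\<rho>. (((X' \<rho> - X \<rho>) /\<^sub>R \<Delta>t) \<bullet> e1) * norm (D X' \<rho>)) (\<lambda>\<rho>. a' \<rho> * a' \<rho>)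
    + 1/2 * L2 (\<lambda>\<rho>. (X \<rho> \<bullet> e1) *
                  ((D (\<lambda>\<rho>. X' \<rho> - X \<rho>) \<rho> \<bullet> D X' \<rho>) / (\<Delta>t * norm (D X \<rho>))))
               (\<lambda>\<rho>. a' \<rho> * a' \<rho>)
    = - L2 (\<lambda>\<rho>. (X \<rho> \<bullet> e1) * (V' \<rho>)\<^sup>2) (\<lambda>\<rho>. norm (D X \<rho>))"
proof -
  note step = assms(1)[unfolded scheme_step_def]
  note tested = step[THEN conjunct2, THEN conjunct2, THEN conjunct2, THEN conjunct2]
  have V: "V' \<in> Vh \<I> J" and a: "a' \<in> Vh \<I> J"
    using step unfolding a'_def by (simp_all only: Vh_diff_const)
  have Da: "D a' \<rho> = D vk' \<rho>" for \<rho>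
    by (simp add: a'_def D_diff_const)
  have eq1: "L2 (\<lambda>\<rho>. (X \<rho> \<bullet> e1) * V' \<rho>) (\<lambda>\<rho>. V' \<rho> * norm (D X \<rho>))
      - L2 (\<lambda>\<rho>. (X \<rho> \<bullet> e1) * D vk' \<rho>) (\<lambda>\<rho>. D V' \<rho> * inverse (norm (D X \<rho>)))
      + 2 * L2 (\<lambda>\<rho>. (normal X \<rho> \<bullet> e1) * \<kappa> \<rho> * a' \<rho>) (\<lambda>\<rho>. V' \<rho> * norm (D X \<rho>))
      + 1/2 * L2 (\<lambda>\<rho>. (X \<rho> \<bullet> e1) * (vk \<rho> + kbar) * vk \<rho> * a' \<rho>) (\<lambda>\<rho>. V' \<rho> * norm (D X \<rho>))
      = 0"
    unfolding a'_def by (rule bspec[OF tested[THEN conjunct1] V])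
  have eq2: "L2 (\<lambda>\<rho>. (X \<rho> \<bullet> e1) * ((vk' \<rho> - vk \<rho>) / \<Delta>t)) (\<lambda>\<rho>. a' \<rho> * norm (D X \<rho>))
      + 1/2 * L2 (\<lambda>\<rho>. (((X' \<rho> - X \<rho>) /\<^sub>R \<Delta>t) \<bullet> e1) * norm (D X' \<rho>)) (\<lambda>\<rho>. a' \<rho> * a' \<rho>)
      + 1/2 * L2 (\<lambda>\<rho>. (X \<rho> \<bullet> e1) *
                      ((D (\<lambda>\<rho>. X' \<rho> - X \<rho>) \<rho> \<bullet> D X' \<rho>) / (\<Delta>t * norm (D X \<rho>))))
                 (\<lambda>\<rho>. a' \<rho> * a' \<rho>)
      + L2 (\<lambda>\<rho>. (X \<rho> \<bullet> e1) * D V' \<rho>) (\<lambda>\<rho>. D a' \<rho> * inverse (norm (D X \<rho>)))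
      - 2 * L2 (\<lambda>\<rho>. (normal X \<rho> \<bullet> e1) * \<kappa> \<rho> * V' \<rho>) (\<lambda>\<rho>. a' \<rho> * norm (D X \<rho>))
      - 1/2 * L2 (\<lambda>\<rho>. (X \<rho> \<bullet> e1) * (vk \<rho> + kbar) * vk \<rho> * V' \<rho>) (\<lambda>\<rho>. a' \<rho> * norm (D X \<rho>))
      - 1/2 * L2 (\<lambda>\<rho>. (X \<rho> \<bullet> e1) * (((X' \<rho> - X \<rho>) \<bullet> tangent X \<rho>) / \<Delta>t))
                 (\<lambda>\<rho>. D vk' \<rho> * a' \<rho> - a' \<rho> * D a' \<rho>)
      = 0"
    using bspec[OF tested[THEN conjunct2, THEN conjunct1] a] unfolding a'_def .
  have "L2 (\<lambda>\<rho>. (X \<rho> \<bullet> e1) * V' \<rho>) (\<lambda>\<rho>. V' \<rho> * norm (D X \<rho>))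
      = L2 (\<lambda>\<rho>. (X \<rho> \<bullet> e1) * (V' \<rho>)\<^sup>2) (\<lambda>\<rho>. norm (D X \<rho>))"
    by (simp add: L2_def power2_eq_square mult_ac)
  moreover have "L2 (\<lambda>\<rho>. (X \<rho> \<bullet> e1) * D vk' \<rho>) (\<lambda>\<rho>. D V' \<rho> * inverse (norm (D X \<rho>)))
      = L2 (\<lambda>\<rho>. (X \<rho> \<bullet> e1) * D V' \<rho>) (\<lambda>\<rho>. D a' \<rho> * inverse (norm (D X \<rho>)))"
    by (simp add: L2_def Da mult_ac)
  moreover have "L2 (\<lambda>\<rho>. (normal X \<rho> \<bullet> e1) * \<kappa> \<rho> * a' \<rho>) (\<lambda>\<rho>. V' \<rho> * norm (D X \<rho>))
      = L2 (\<lambda>\<rho>. (normal X \<rho> \<bullet> e1) * \<kappa> \<rho> * V' \<rho>) (\<lambda>\<rho>. a' \<rho> * norm (D X \<rho>))"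
    by (simp add: L2_def mult_ac)
  moreover have "L2 (\<lambda>\<rho>. (X \<rho> \<bullet> e1) * (vk \<rho> + kbar) * vk \<rho> * a' \<rho>) (\<lambda>\<rho>. V' \<rho> * norm (D X \<rho>))
      = L2 (\<lambda>\<rho>. (X \<rho> \<bullet> e1) * (vk \<rho> + kbar) * vk \<rho> * V' \<rho>) (\<lambda>\<rho>. a' \<rho> * norm (D X \<rho>))"
    by (simp add: L2_def mult_ac)
  moreover have "L2 (\<lambda>\<rho>. (X \<rho> \<bullet> e1) * (((X' \<rho> - X \<rho>) \<bullet> tangent X \<rho>) / \<Delta>t))
                 (\<lambda>\<rho>. D vk' \<rho> * a' \<rho> - a' \<rho> * D a' \<rho>) = 0"
    by (simp add: L2_def Da mult.commute)
  ultimately show ?thesis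
    using eq1 eq2 by linarith
qed

lemma energy_increment_le:
  fixes kbar :: real
  assumes J: "J \<ge> 1" and \<Delta>t: "\<Delta>t > 0"
    and X: "admissible \<I> J X" and X': "X' \<in> Vh_bdry \<I> J"
    and vk: "vk \<in> Vh \<I> J" and vk': "vk' \<in> Vh \<I> J"
  defines "a' \<equiv> \<lambda>\<rho>. vk' \<rho> - kbar"
  shows "energy kbar X' vk' - energy kbar X vk
    \<le> 2 * pi * \<Delta>t *
     (L2 (\<lambda>\<rho>. (X \<rho> \<bullet> e1) * ((vk' \<rho> - vk \<rho>) / \<Delta>t)) (\<lambda>\<rho>. a' \<rho> * norm (D X \<rho>))
      + 1/2 * L2 (\<lambda>\<rho>. (((X' \<rho> - X \<rho>) /\<^sub>R \<Delta>t) \<bullet> e1) * norm (D X' \<rho>)) (\<lambda>\<rho>. a' \<rho> * a' \<rho>)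
      + 1/2 * L2 (\<lambda>\<rho>. (X \<rho> \<bullet> e1) *
                    ((D (\<lambda>\<rho>. X' \<rho> - X \<rho>) \<rho> \<bullet> D X' \<rho>) / (\<Delta>t * norm (D X \<rho>))))
                 (\<lambda>\<rho>. a' \<rho> * a' \<rho>))"
proof -
  let ?N = "node J ` {0..J}"
  let ?a = "\<lambda>\<rho>. vk \<rho> - kbar"
  let ?W = "\<lambda>\<rho>. D (\<lambda>\<rho>. X' \<rho> - X \<rho>) \<rho>"
  define E' where "E' = (\<lambda>\<rho>. ((X' \<rho> \<bullet> e1) * (a' \<rho>)\<^sup>2) * norm (D X' \<rho>))"
  define E where "E = (\<lambda>\<rho>. ((X \<rho> \<bullet> e1) * (?a \<rho>)\<^sup>2) * norm (D X \<rho>))"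
  define A where "A = (\<lambda>\<rho>. ((X \<rho> \<bullet> e1) * (a' \<rho> - ?a \<rho>) * a' \<rho>) * norm (D X \<rho>))"
  define B where "B = (\<lambda>\<rho>. (((X' \<rho> - X \<rho>) \<bullet> e1) * (a' \<rho>)\<^sup>2) * norm (D X' \<rho>))"
  define C where "C = (\<lambda>\<rho>. ((X \<rho> \<bullet> e1) * (a' \<rho>)\<^sup>2) * ((?W \<rho> \<bullet> D X' \<rho>) / norm (D X \<rho>)))"
  have X_Vh: "X \<in> Vh_bdry \<I> J"
    using X by (simp add: admissible_def)
  note affine = Vh_bdry_pw_affine[OF X_Vh] Vh_bdry_pw_affine[OF X']
  note cont = Vh_bdry_continuous[OF X_Vh] Vh_bdry_continuous[OF X']
    Vh_continuous[OF vk] Vh_continuous[OF vk']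
  note D = pw_const_D[OF affine(1)] pw_const_D[OF affine(2)]
    pw_const_D[OF pw_affine_diff[OF affine(2,1)]]
  have pw: "pw_const J (\<lambda>\<rho>. norm (D X \<rho>))" "pw_const J (\<lambda>\<rho>. norm (D X' \<rho>))"
    "pw_const J (\<lambda>\<rho>. (?W \<rho> \<bullet> D X' \<rho>) / norm (D X \<rho>))"
    by (fact pw_const_compose[OF D(1)] pw_const_compose[OF D(2)]
        pw_const_compose2[OF pw_const_compose2[OF D(3,2), where F = "(\<bullet>)"]
          pw_const_compose[OF D(1), where F = norm], where F = "(/)"])+
  have "continuous_on {0..1} (\<lambda>\<rho>. (X' \<rho> \<bullet> e1) * (a' \<rho>)\<^sup>2)"
    "continuous_on {0..1} (\<lambda>\<rho>. (X \<rho> \<bullet> e1) * (?a \<rho>)\<^sup>2)"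
    "continuous_on {0..1} (\<lambda>\<rho>. (X \<rho> \<bullet> e1) * (a' \<rho> - ?a \<rho>) * a' \<rho>)"
    "continuous_on {0..1} (\<lambda>\<rho>. ((X' \<rho> - X \<rho>) \<bullet> e1) * (a' \<rho>)\<^sup>2)"
    "continuous_on {0..1} (\<lambda>\<rho>. (X \<rho> \<bullet> e1) * (a' \<rho>)\<^sup>2)"
    unfolding a'_def by (intro continuous_intros cont)+
  note int = this(1)[THEN integrable_continuous_times_pw_const, OF pw(2) J, folded E'_def]
    this(2)[THEN integrable_continuous_times_pw_const, OF pw(1) J, folded E_def]
    this(3)[THEN integrable_continuous_times_pw_const, OF pw(1) J, folded A_def]
    this(4)[THEN integrable_continuous_times_pw_const, OF pw(2) J, folded B_def]
    this(5)[THEN integrable_continuous_times_pw_const, OF pw(3) J, folded C_def]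
  have "E' \<rho> - E \<rho> \<le> 2 * A \<rho> + B \<rho> + C \<rho>" if \<rho>: "\<rho> \<in> {0..1} - ?N" for \<rho>
  proof -
    have "?W \<rho> = D X' \<rho> - D X \<rho>"
      using \<rho> by (intro vector_derivative_diff_at pw_affine_differentiable[OF affine(1) J]
          pw_affine_differentiable[OF affine(2) J]) auto
    moreover have "X \<rho> \<bullet> e1 \<ge> 0" "norm (D X \<rho>) > 0"
      using \<rho> admissible_radius_nonneg[OF X] admissible_speed_pos[OF X J] by auto
    ultimately show ?thesis
      using energy_density_increment_le[of "X \<rho> \<bullet> e1" "D X \<rho>" "X' \<rho> \<bullet> e1" "a' \<rho>" "D X' \<rho>" "?a \<rho>"]
      by (simp add: E'_def E_def A_def B_def C_def inner_diff_left mult_ac)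
  qed
  then have "integral {0..1} (\<lambda>\<rho>. E' \<rho> - E \<rho>) \<le> integral {0..1} (\<lambda>\<rho>. 2 * A \<rho> + B \<rho> + C \<rho>)"
    by (intro integral_le_off_finite[of ?N] integrable_add integrable_diff integrable_on_mult_right int)
      auto
  also have "\<dots> = 2 * integral {0..1} A + integral {0..1} B + integral {0..1} C"
    by (simp add: integral_add integrable_add integrable_on_mult_right int)
  finally have "integral {0..1} E' - integral {0..1} E
      \<le> 2 * integral {0..1} A + integral {0..1} B + integral {0..1} C"
    by (simp add: integral_diff int)
  then have le: "pi * (integral {0..1} E' - integral {0..1} E)
      \<le> pi * (2 * integral {0..1} A + integral {0..1} B + integral {0..1} C)"
    by (intro mult_left_mono) auto
  have energies: "energy kbar X' vk' = pi * integral {0..1} E'" "energy kbar X vk = pi * integral {0..1} E"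
    by (simp_all add: energy_def E'_def E_def a'_def)
  have A: "\<Delta>t * L2 (\<lambda>\<rho>. (X \<rho> \<bullet> e1) * ((vk' \<rho> - vk \<rho>) / \<Delta>t)) (\<lambda>\<rho>. a' \<rho> * norm (D X \<rho>))
      = integral {0..1} A"
    using \<Delta>t unfolding L2_def A_def a'_def
    by (subst integral_mult_right[symmetric]) (simp add: mult_ac)
  have B: "\<Delta>t * L2 (\<lambda>\<rho>. (((X' \<rho> - X \<rho>) /\<^sub>R \<Delta>t) \<bullet> e1) * norm (D X' \<rho>)) (\<lambda>\<rho>. a' \<rho> * a' \<rho>)
      = integral {0..1} B"
    using \<Delta>t unfolding L2_def B_def
    by (subst integral_mult_right[symmetric]) (simp add: power2_eq_square mult_ac)
  have C: "\<Delta>t * L2 (\<lambda>\<rho>. (X \<rho> \<bullet> e1) * ((?W \<rho> \<bullet> D X' \<rho>) / (\<Delta>t * norm (D X \<rho>))))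
      (\<lambda>\<rho>. a' \<rho> * a' \<rho>) = integral {0..1} C"
    using \<Delta>t unfolding L2_def C_def
    by (subst integral_mult_right[symmetric]) (simp add: power2_eq_square mult_ac)
  have factor: "2 * pi * \<Delta>t * (x + 1/2 * y + 1/2 * z) = pi * (2 * (\<Delta>t * x) + \<Delta>t * y + \<Delta>t * z)"
    for x y z
    by (simp add: algebra_simps)
  show ?thesis
    unfolding factor A B C energies using le by (simp only: right_diff_distrib)
qed

theorem theorem4p4:
  fixes \<I> :: domain
    and J M m :: nat
    and T \<Delta>t kbar :: real
    and X :: "nat \<Rightarrow> real \<Rightarrow> real^2"
    and V vk \<kappa> :: "nat \<Rightarrow> real \<Rightarrow> real"
  assumes "J \<ge> 1" and "T > 0" and "\<Delta>t = T / real M"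
    and "m < M"
    and "\<And>n. n \<le> M \<Longrightarrow> admissible \<I> J (X n)"
    and "vk m \<in> Vh \<I> J" and "\<kappa> m \<in> Vh \<I> J"
    and "scheme_step \<I> J kbar \<Delta>t (X m) (vk m) (\<kappa> m)
           (V (Suc m)) (vk (Suc m)) (\<kappa> (Suc m)) (X (Suc m))"
  shows "energy kbar (X (Suc m)) (vk (Suc m))
           + 2 * pi * \<Delta>t * L2 (\<lambda>\<rho>. (X m \<rho> \<bullet> e1) * (V (Suc m) \<rho>)\<^sup>2) (\<lambda>\<rho>. norm (D (X m) \<rho>))
         \<le> energy kbar (X m) (vk m)"
proof -
  have \<Delta>t: "\<Delta>t > 0"
    using assms(2-4) by simp
  have X: "admissible \<I> J (X m)"
    using assms(4,5) by simp
  have vk': "vk (Suc m) \<in> Vh \<I> J" and X': "X (Suc m) \<in> Vh_bdry \<I> J"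
    using assms(8) by (simp_all add: scheme_step_def)
  have "energy kbar (X (Suc m)) (vk (Suc m)) - energy kbar (X m) (vk m)
      \<le> 2 * pi * \<Delta>t * - L2 (\<lambda>\<rho>. (X m \<rho> \<bullet> e1) * (V (Suc m) \<rho>)\<^sup>2) (\<lambda>\<rho>. norm (D (X m) \<rho>))"
    using energy_increment_le[OF assms(1) \<Delta>t X X' assms(6) vk', where kbar = kbar]
    unfolding scheme_step_energy_identity[OF assms(8)] .
  then show ?thesis
    by simp
qed

end
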